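(* Let $\mathscr D=\{d_1,\ldots,d_n\}$ be a set of positive integers with $d_1>d_2>\cdots>d_n$. Define a sequence $\overline{\mathbf s}$ as follows. Case (a): $\sigma(\mathscr D)$ is even or $d_n$ is odd. Let $\mathbf s=d_1,\ldots,d_n$, $c=\max_{1\le k\le n-1}\left\lceil \frac{-\Delta_{\mathbf s}(k)}{\min\{k,d_n\}}\right\rceil$, and $C^{\star}=c$ if $d_n$ and $\sigma(\mathscr D)$ are even or if $d_n$ is odd and $\sigma(\mathscr D)+cd_n$ is even, while $C^{\star}=c+1$ if $d_n$ and $\sigma(\mathscr D)+cd_n$ are odd. Set $\overline{\mathbf s}=d_1,\ldots,d_{n-1},(d_n)_{C^{\star}+1}$. Case (b): $\sigma(\mathscr D)$ is odd and $d_n$ is even. Let $r=\max\{i:d_i\text{ odd}\}$, $\mathbf s=d_1,\ldots,d_{r-1},(d_r)_2,d_{r+1},\ldots,d_n$, $C^{\star}=\max_{1\le k\le n}\left\lceil \frac{-\Delta_{\mathbf s}(k)}{\min\{k,d_n\}}\right\rceil$, and let $\overline{\mathbf s}$ be $\mathbf s$ followed by $C^{\star}$ further copies of $d_n$. Then $\overline{\mathbf s}$ is a graphic sequence with set of distinct terms $\mathscr D$, and \[ \tfrac12\sigma(\overline{\mathbf s})-\ell_q(\mathscr D)<\min\mathscr D. \]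
   Context: All graphs are finite and simple. A nonincreasing sequence $a_1,\ldots,a_p$ of nonnegative integers is graphic if there is a simple graph with vertices $v_1,\ldots,v_p$ such that $\deg v_k=a_k$ for each $k$. The degree set of a graph is the set of distinct degrees of its vertices. For a finite nonempty set $\mathscr D$ of positive integers, $\ell_q(\mathscr D)$ denotes the least number of edges of a simple graph whose degree set is exactly $\mathscr D$. The notation $(d)_m$ denotes $m$ consecutive occurrences of $d$ in a sequence. $\sigma(\mathscr D)$ is the sum of the elements of $\mathscr D$ and $\sigma(\overline{\mathbf s})$ the sum of the terms of $\overline{\mathbf s}$. For a sequence $\mathbf s=a_1,\ldots,a_p$ and $1\le k\le p$, $\Delta_{\mathbf s}(k)=k(k-1)+\sum_{i=k+1}^{p}\min\{k,a_i\}-\sum_{i=1}^{k}a_i$.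
   Formalization: For n = 1 the maximum defining c in case (a) ranges over the empty set and is undefined; the formal statement then takes the maximum over k = 1 alone, giving c = d_1 and the degree sequence of the complete graph on d_1+1 vertices. For n ≥ 2 nothing is changed. *)

theory Defs
  imports Complex_Main
begin

definition simple_graph :: "'v set \<Rightarrow> 'v set set \<Rightarrow> bool" where
  "simple_graph V E \<longleftrightarrow> finite V \<and> E \<subseteq> {e. e \<subseteq> V \<and> card e = 2}"

definition vertex_degree :: "'v set set \<Rightarrow> 'v \<Rightarrow> nat" where
  "vertex_degree E v = card {e \<in> E. v \<in> e}"

definition degree_set :: "'v set \<Rightarrow> 'v set set \<Rightarrow> nat set" where
  "degree_set V E = vertex_degree E ` V"

(* Sequences are lists; the k-th term a_k (k = 1, ..., length a) is a ! (k - 1). *)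
definition graphic :: "nat list \<Rightarrow> bool" where
  "graphic a \<longleftrightarrow> sorted_wrt (\<ge>) a \<and>
     (\<exists>E. simple_graph {1..length a} E \<and>
          (\<forall>k\<in>{1..length a}. vertex_degree E k = a ! (k - 1)))"

(* Every finite graph is isomorphic to one whose vertices are natural numbers. *)
definition least_size :: "nat set \<Rightarrow> nat" where
  "least_size D =
     (LEAST q. \<exists>(V :: nat set) E. simple_graph V E \<and> degree_set V E = D \<and> card E = q)"

definition Delta :: "nat list \<Rightarrow> nat \<Rightarrow> int" where
  "Delta s k = int k * (int k - 1)
     + (\<Sum>i = k + 1..length s. int (min k (s ! (i - 1))))
     - (\<Sum>i = 1..k. int (s ! (i - 1)))"

definition deficiency :: "nat list \<Rightarrow> nat \<Rightarrow> nat \<Rightarrow> int" where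
  "deficiency s m k = \<lceil>real_of_int (- Delta s k) / real (min k m)\<rceil>"

(* In what follows ds = [d_1, ..., d_n] is strictly decreasing, with d_n = last ds. *)

(* The maximum is over k = 1, ..., n - 1. For n = 1 that range would be empty; only then
   does the outer max matter: it admits k = 1, which gives the sequence of the complete
   graph on d_1 + 1 vertices. *)
definition c_a :: "nat list \<Rightarrow> int" where
  "c_a ds = Max (deficiency ds (last ds) ` {1..max 1 (length ds - 1)})"

definition Cstar_a :: "nat list \<Rightarrow> int" where
  "Cstar_a ds =
     (if even (last ds) \<and> even (\<Sum>(set ds))
       \<or> odd (last ds) \<and> even (int (\<Sum>(set ds)) + c_a ds * int (last ds))
      then c_a ds else c_a ds + 1)"

(* In both cases the number of copies is nonnegative, as the term k = 1 of the maximum is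
   (d_1 >= n), so the conversions nat lose nothing. *)
definition sbar_a :: "nat list \<Rightarrow> nat list" where
  "sbar_a ds = butlast ds @ replicate (nat (Cstar_a ds + 1)) (last ds)"

definition last_odd_index :: "nat list \<Rightarrow> nat" where
  "last_odd_index ds = Max {i \<in> {1..length ds}. odd (ds ! (i - 1))}"

definition s_b :: "nat list \<Rightarrow> nat list" where
  "s_b ds = (let r = last_odd_index ds in
     take (r - 1) ds @ replicate 2 (ds ! (r - 1)) @ drop r ds)"

definition Cstar_b :: "nat list \<Rightarrow> int" where
  "Cstar_b ds = Max (deficiency (s_b ds) (last ds) ` {1..length ds})"

definition sbar_b :: "nat list \<Rightarrow> nat list" where
  "sbar_b ds = s_b ds @ replicate (nat (Cstar_b ds)) (last ds)"

definition sbar :: "nat list \<Rightarrow> nat list" where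
  "sbar ds = (if even (\<Sum>(set ds)) \<or> odd (last ds) then sbar_a ds else sbar_b ds)"

end

theory Submission
  imports Defs
begin

text \<open>
  Appending \<open>C\<close> copies of the minimum \<open>m\<close> to \<open>s\<close> raises \<open>Delta s k\<close> by \<open>C * min k m\<close>, so the
  number of copies in the construction is the least one for which the Erdos-Gallai inequalities
  hold (up to a possible extra copy for parity). Conversely, let \<open>G\<close> be a graph with degree set
  \<open>D\<close> and embed \<open>s\<close> into its vertices, a term going to a vertex of at least that degree. The
  Erdos-Gallai inequality for the images of the first \<open>k\<close> terms, with \<open>k\<close> attaining the maximal
  deficiency \<open>c\<close>, shows that the degree sum of \<open>G\<close> exceeds the sum of \<open>s\<close> by more than
  \<open>(c - 1) * m\<close>, while \<open>C\<close> is at most \<open>c + 1\<close>. In case (b) the repeated odd term \<open>d_r\<close> embeds because the degrees of \<open>G\<close> have even sum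
  while \<open>D\<close> has odd sum, which forces another vertex of odd degree, and \<open>d_r\<close> is the least odd
  element of \<open>D\<close>.

  The sufficiency of the Erdos-Gallai inequalities follows Tripathi, Venugopalan and West: fill the
  degrees in order, keeping the vertices after the current one independent.
\<close>

section \<open>Degree counting in simple graphs\<close>

lemma vertex_degree_insert:
  assumes "finite E" "e \<notin> E"
  shows "vertex_degree (insert e E) v = vertex_degree E v + of_bool (v \<in> e)"
proof -
  have "{x \<in> insert e E. v \<in> x} = (if v \<in> e then insert e {x \<in> E. v \<in> x} else {x \<in> E. v \<in> x})"
    by auto
  then show ?thesis using assms by (simp add: vertex_degree_def)
qed

lemma vertex_degree_remove:
  assumes "finite E" "e \<in> E"
  shows "int (vertex_degree (E - {e}) v) = int (vertex_degree E v) - of_bool (v \<in> e)"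
  using vertex_degree_insert[of "E - {e}" e v] assms by (simp add: insert_absorb)

lemma simple_graph_finite_edges:
  assumes "simple_graph V E" shows "finite E"
  using assms unfolding simple_graph_def
  by (auto intro: finite_subset[of _ "Pow V"])

lemma simple_graph_edge:
  assumes "simple_graph V E" "{a, b} \<in> E"
  shows "a \<in> V" "b \<in> V" "a \<noteq> b"
proof -
  have "{a, b} \<subseteq> V" "card {a, b} = 2" using assms by (auto simp: simple_graph_def)
  then show "a \<in> V" "b \<in> V" "a \<noteq> b" by auto
qed

lemma simple_graph_insert:
  assumes "simple_graph V E" "a \<in> V" "b \<in> V" "a \<noteq> b"
  shows "simple_graph V (insert {a, b} E)"
  using assms by (auto simp: simple_graph_def)

lemma simple_graph_subset:
  assumes "simple_graph V E" "F \<subseteq> E"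
  shows "simple_graph V F"
  using assms by (auto simp: simple_graph_def)

lemma vertex_degree_neighbours:
  assumes "simple_graph V E"
  shows "vertex_degree E v = card {u \<in> V. {u, v} \<in> E}"
proof -
  have "bij_betw (\<lambda>u. {u, v}) {u \<in> V. {u, v} \<in> E} {e \<in> E. v \<in> e}"
  proof (rule bij_betw_imageI)
    show "inj_on (\<lambda>u. {u, v}) {u \<in> V. {u, v} \<in> E}"
      by (auto simp: inj_on_def doubleton_eq_iff)
    have "\<exists>u\<in>V. {u, v} \<in> E \<and> e = {u, v}" if "e \<in> E" "v \<in> e" for e
    proof -
      have "card e = 2" "e \<subseteq> V" using assms that by (auto simp: simple_graph_def)
      then obtain a b where "e = {a, b}" by (auto simp: card_2_iff)
      with that \<open>e \<subseteq> V\<close> show ?thesis by (auto simp: insert_commute)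
    qed
    then show "(\<lambda>u. {u, v}) ` {u \<in> V. {u, v} \<in> E} = {e \<in> E. v \<in> e}" by auto
  qed
  then show ?thesis by (simp add: vertex_degree_def bij_betw_same_card)
qed

lemma card_filter_swap:
  assumes "finite A" "finite B"
  shows "(\<Sum>a\<in>A. card {b \<in> B. P a b}) = (\<Sum>b\<in>B. card {a \<in> A. P a b})"
proof -
  have *: "card {b \<in> B. Q b} = (\<Sum>b\<in>B. of_bool (Q b))" if "finite B" for B :: "'c set" and Q
    using that by (simp add: sum_of_bool_eq Int_def)
  show ?thesis using assms sum.swap[of "\<lambda>a b. of_bool (P a b) :: nat" B A] by (simp add: *)
qed

lemma handshake:
  assumes "simple_graph V E"
  shows "(\<Sum>v\<in>V. vertex_degree E v) = 2 * card E"
proof -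
  have fin: "finite V" "finite E"
    using assms simple_graph_finite_edges by (auto simp: simple_graph_def)
  have "(\<Sum>v\<in>V. vertex_degree E v) = (\<Sum>e\<in>E. card {v \<in> V. v \<in> e})"
    unfolding vertex_degree_def by (rule card_filter_swap[OF fin])
  also have "\<dots> = (\<Sum>e\<in>E. 2)"
  proof (rule sum.cong)
    fix e assume "e \<in> E"
    then have "e \<subseteq> V" "card e = 2" using assms by (auto simp: simple_graph_def)
    moreover from this have "{v \<in> V. v \<in> e} = e" by auto
    ultimately show "card {v \<in> V. v \<in> e} = 2" by simp
  qed simp
  finally show ?thesis by simp
qed

text \<open>Neighbours inside and outside \<open>K\<close> are counted separately; an edge leaving
  \<open>K\<close> is charged to its outer end. The exact form serves twice: bounding both sums
  gives the Erdos-Gallai inequality, and evaluating them gives the contradiction in the proof of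
  sufficiency.\<close>

lemma degree_sum_split:
  assumes "simple_graph V E" "K \<subseteq> V"
  shows "(\<Sum>v\<in>K. vertex_degree E v) =
    (\<Sum>v\<in>K. card {u \<in> K. {u, v} \<in> E}) + (\<Sum>w\<in>V - K. card {u \<in> K. {u, w} \<in> E})"
proof -
  have fin: "finite V" "finite K" using assms finite_subset by (auto simp: simple_graph_def)
  have "vertex_degree E v = card {u \<in> K. {u, v} \<in> E} + card {w \<in> V - K. {v, w} \<in> E}" for v
  proof -
    have "{u \<in> V. {u, v} \<in> E} = {u \<in> K. {u, v} \<in> E} \<union> {w \<in> V - K. {v, w} \<in> E}"
      using assms(2) by (auto simp: insert_commute)
    then show ?thesis
      unfolding vertex_degree_neighbours[OF assms(1)]
      using fin by (simp add: card_Un_disjoint disjoint_iff)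
  qed
  then show ?thesis
    using card_filter_swap[of K "V - K" "\<lambda>v w. {v, w} \<in> E"] fin by (simp add: sum.distrib)
qed

text \<open>Necessity of the Erdos-Gallai inequality, for an arbitrary vertex set \<open>K\<close>
  instead of the vertices of largest degree: \<open>K\<close> will be the image of the first terms
  of an embedded sequence.\<close>

lemma degree_sum_le:
  assumes G: "simple_graph V E" and K: "K \<subseteq> V"
  shows "(\<Sum>v\<in>K. vertex_degree E v)
    \<le> card K * (card K - 1) + (\<Sum>w\<in>V - K. min (card K) (vertex_degree E w))"
proof -
  have fin: "finite V" "finite K" using assms finite_subset by (auto simp: simple_graph_def)
  have "card {u \<in> K. {u, v} \<in> E} \<le> card K - 1" if "v \<in> K" for v
  proof -
    have "{u \<in> K. {u, v} \<in> E} \<subseteq> K - {v}" using simple_graph_edge(3)[OF G, of v v] by auto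
    from card_mono[OF _ this] that fin show ?thesis by simp
  qed
  then have "(\<Sum>v\<in>K. card {u \<in> K. {u, v} \<in> E}) \<le> card K * (card K - 1)"
    using sum_mono[of K _ "\<lambda>_. card K - 1"] by simp
  moreover have "card {u \<in> K. {u, w} \<in> E} \<le> min (card K) (vertex_degree E w)" for w
    unfolding vertex_degree_neighbours[OF G]
    using fin K by (auto intro!: card_mono)
  then have "(\<Sum>w\<in>V - K. card {u \<in> K. {u, w} \<in> E}) \<le>
      (\<Sum>w\<in>V - K. min (card K) (vertex_degree E w))"
    by (intro sum_mono)
  ultimately show ?thesis using degree_sum_split[OF assms] by simp
qed

text \<open>Otherwise the neighbours of \<open>w\<close> would inject into those of
  \<open>v\<close>. Such a vertex \<open>u\<close> is what each edge switch below starts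
  from.\<close>

lemma exists_private_neighbour:
  assumes G: "simple_graph V E" and less: "vertex_degree E v < vertex_degree E w"
  shows "\<exists>u. {u, w} \<in> E \<and> u \<noteq> v \<and> {u, v} \<notin> E"
proof (rule ccontr)
  assume "\<nexists>u. {u, w} \<in> E \<and> u \<noteq> v \<and> {u, v} \<notin> E"
  then have *: "{u, v} \<in> E" if "{u, w} \<in> E" "u \<noteq> v" for u using that by blast
  have "card {u \<in> V. {u, w} \<in> E} \<le> card {u \<in> V. {u, v} \<in> E}"
  proof (rule card_inj_on_le)
    \<comment> \<open>If \<open>v\<close> itself is a neighbour of \<open>w\<close>, it is sent to
      \<open>w\<close>, which is then a neighbour of \<open>v\<close>; no other vertex is sent there
      because \<open>w\<close> is not its own neighbour.\<close>
    show "inj_on (\<lambda>u. if u = v then w else u) {u \<in> V. {u, w} \<in> E}"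
      using simple_graph_edge(3)[OF G] by (auto simp: inj_on_def)
    show "(\<lambda>u. if u = v then w else u) ` {u \<in> V. {u, w} \<in> E} \<subseteq> {u \<in> V. {u, v} \<in> E}"
    proof (rule image_subsetI)
      fix u assume u: "u \<in> {u \<in> V. {u, w} \<in> E}"
      then have "{w, u} \<in> E" "w \<in> V" using simple_graph_edge(2)[OF G] by (auto simp: insert_commute)
      with u *[of u] show "(if u = v then w else u) \<in> {u \<in> V. {u, v} \<in> E}" by auto
    qed
    show "finite {u \<in> V. {u, v} \<in> E}" using G by (simp add: simple_graph_def)
  qed
  with less show False by (simp add: vertex_degree_neighbours[OF G])
qed

section \<open>Sufficiency of the Erdos-Gallai inequalities\<close>

text \<open>The vertex \<open>r\<close> is the one being filled. The last conjunct says that the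
  vertices after \<open>r\<close> are independent. The value \<open>r = n + 1\<close> is allowed and
  describes a full realization.\<close>

definition subrealization :: "(nat \<Rightarrow> nat) \<Rightarrow> nat \<Rightarrow> nat \<Rightarrow> nat set set \<Rightarrow> bool" where
  "subrealization d n r E \<longleftrightarrow> simple_graph {1..n} E
     \<and> (\<forall>v\<in>{1..n}. vertex_degree E v \<le> d v)
     \<and> (\<forall>v\<in>{1..<r}. vertex_degree E v = d v)
     \<and> (\<forall>e\<in>E. \<exists>v\<in>e. v \<le> r)"

lemma subrealization_add_edge:
  assumes sub: "subrealization d n r E" and r: "r \<in> {1..n}" "vertex_degree E r < d r"
    and k: "k \<in> {1..n}" "k \<noteq> r" "vertex_degree E k < d k" "{r, k} \<notin> E"
  shows "\<exists>E'. subrealization d n r E' \<and> vertex_degree E r < vertex_degree E' r"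
proof (intro exI conjI)
  let ?E = "insert {r, k} E"
  have G: "simple_graph {1..n} E" using sub by (simp add: subrealization_def)
  note deg = vertex_degree_insert[OF simple_graph_finite_edges[OF G] k(4)]
  show "vertex_degree E r < vertex_degree ?E r" by (simp add: deg)
  \<comment> \<open>A deficient vertex is not among the finished ones, so raising its degree is
    harmless.\<close>
  have "k \<notin> {1..<r}" using k(3) sub by (auto simp: subrealization_def)
  then have "vertex_degree ?E v = d v" if "v \<in> {1..<r}" for v
    using that sub by (auto simp: deg subrealization_def)
  moreover have "vertex_degree ?E v \<le> d v" if "v \<in> {1..n}" for v
    using that sub k r by (auto simp: deg subrealization_def)
  moreover have "simple_graph {1..n} ?E"
    using simple_graph_insert[OF G] k r by blast
  ultimately show "subrealization d n r ?E"
    using sub by (auto simp: subrealization_def)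
qed

text \<open>The edge \<open>u i\<close> is replaced by \<open>u r\<close> and \<open>i j\<close>. The surplus at \<open>j\<close> is later absorbed by a
  deficiency of \<open>j\<close> or by deleting a further edge.\<close>
lemma subrealization_switch:
  assumes sub: "subrealization d n r E" and r: "r \<in> {1..n}"
    and i: "i \<in> {1..<r}" and u: "{u, i} \<in> E" "u \<noteq> r" "{u, r} \<notin> E"
    and j: "j \<in> {1..n}" "j \<noteq> i" "{i, j} \<notin> E"
  obtains F where "simple_graph {1..n} F" "E - {{u, i}} \<subseteq> F" "\<And>e. e \<in> F \<Longrightarrow> \<exists>v\<in>e. v \<le> r"
    "\<And>v. vertex_degree F v = vertex_degree E v + of_bool (v = r) + of_bool (v = j)"
proof
  define F where "F = insert {i, j} (insert {u, r} (E - {{u, i}}))"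
  have G: "simple_graph {1..n} E" using sub by (simp add: subrealization_def)
  note fin = simple_graph_finite_edges[OF G]
  note ui = simple_graph_edge[OF G u(1)]
  show "simple_graph {1..n} F" unfolding F_def
    using ui r u(2) j by (intro simple_graph_insert simple_graph_subset[OF G]) auto
  show "E - {{u, i}} \<subseteq> F" by (auto simp: F_def)
  show "\<exists>v\<in>e. v \<le> r" if "e \<in> F" for e
    using that sub i by (auto simp: F_def subrealization_def)
  show "vertex_degree F v = vertex_degree E v + of_bool (v = r) + of_bool (v = j)" for v
  proof -
    have "{i, j} \<notin> insert {u, r} (E - {{u, i}})" using ui i j by (auto simp: doubleton_eq_iff)
    moreover have "{u, r} \<notin> E - {{u, i}}" using u by auto
    \<comment> \<open>The losses at \<open>u\<close> and \<open>i\<close> are made up by the two new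
      edges, leaving a gain of one each at \<open>r\<close> and \<open>j\<close>; for
      \<open>j = r\<close> the gain is two.\<close>
    ultimately have "int (vertex_degree F v) = int (vertex_degree E v) - of_bool (v \<in> {u, i})
        + of_bool (v \<in> {u, r}) + of_bool (v \<in> {i, j})"
      using fin u(1) by (simp add: F_def vertex_degree_insert vertex_degree_remove)
    then show ?thesis using ui u(2) i j(2) by (auto split: if_splits simp: of_bool_def)
  qed
qed

text \<open>If no step raises the degree of \<open>r\<close>, then \<open>{1..r}\<close> is a clique
  and every later vertex \<open>k\<close> has degree \<open>min r (d k)\<close>. The first
  \<open>r\<close> degrees then sum to the right-hand side of the Erdos-Gallai inequality, although
  \<open>r\<close> is still deficient.\<close>

lemma subrealization_improve:
  assumes mono: "\<And>i j. 1 \<le> i \<Longrightarrow> i \<le> j \<Longrightarrow> j \<le> n \<Longrightarrow> d j \<le> d i"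
    and ev: "even (\<Sum>v = 1..n. d v)"
    and EG: "(\<Sum>i = 1..r. d i) \<le> r * (r - 1) + (\<Sum>i = r + 1..n. min r (d i))"
    and r: "r \<in> {1..n}" and sub: "subrealization d n r E" and less: "vertex_degree E r < d r"
  shows "\<exists>E'. subrealization d n r E' \<and> vertex_degree E r < vertex_degree E' r"
proof (rule ccontr)
  let ?deg = "vertex_degree E"
  assume contra: "\<not> ?thesis"
  have G: "simple_graph {1..n} E" and le: "\<And>v. v \<in> {1..n} \<Longrightarrow> ?deg v \<le> d v"
    and eq: "\<And>v. v \<in> {1..<r} \<Longrightarrow> ?deg v = d v" and meet: "\<And>e. e \<in> E \<Longrightarrow> \<exists>v\<in>e. v \<le> r"
    using sub by (auto simp: subrealization_def)
  have no_better: False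
    if "simple_graph {1..n} F" "\<And>e. e \<in> F \<Longrightarrow> \<exists>v\<in>e. v \<le> r" "?deg r < vertex_degree F r"
      "\<And>v. v \<in> {1..n} \<Longrightarrow> vertex_degree F v \<le> d v"
      "\<And>v. v \<in> {1..<r} \<Longrightarrow> vertex_degree F v = ?deg v" for F
  proof -
    have "subrealization d n r F" using that eq by (simp add: subrealization_def)
    then show False using contra that(3) by blast
  qed
  have priv: "\<exists>u. {u, i} \<in> E \<and> u \<noteq> r \<and> {u, r} \<notin> E" if "i \<in> {1..<r}" for i
  proof (rule exists_private_neighbour[OF G])
    have "d r \<le> d i" using mono[of i r] that r by auto
    then show "?deg r < ?deg i" using less eq[OF that] by simp
  qed
  have adj_deficient: "{r, k} \<in> E" if "k \<in> {1..n}" "k \<noteq> r" "?deg k < d k" for k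
    using subrealization_add_edge[OF sub r less that] contra by blast
  \<comment> \<open>A switch with \<open>j = r\<close> raises the degree of \<open>r\<close> by two.
    If only one is missing, parity supplies another deficient vertex \<open>k\<close>, and deleting
    the edge from \<open>r\<close> to \<open>k\<close> removes the surplus.\<close>
  have adj_r: "{i, r} \<in> E" if i: "i \<in> {1..<r}" for i
  proof (rule ccontr)
    assume nadj: "{i, r} \<notin> E"
    obtain u where u: "{u, i} \<in> E" "u \<noteq> r" "{u, r} \<notin> E" using priv[OF i] by blast
    obtain F where F: "simple_graph {1..n} F" "E - {{u, i}} \<subseteq> F" "\<And>e. e \<in> F \<Longrightarrow> \<exists>v\<in>e. v \<le> r"
      "\<And>v. vertex_degree F v = ?deg v + of_bool (v = r) + of_bool (v = r)"
      using subrealization_switch[OF sub r i u r _ nadj] i by auto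
    show False
    proof (cases "?deg r + 2 \<le> d r")
      case True
      then have "vertex_degree F v \<le> d v" if "v \<in> {1..n}" for v
        using le[OF that] by (auto simp: F(4))
      then show False using no_better[OF F(1,3)] by (simp add: F(4))
    next
      case False
      then have dr: "d r = ?deg r + 1" using less by simp
      have "\<exists>k\<in>{1..n}. k \<noteq> r \<and> ?deg k < d k"
      proof (rule ccontr)
        assume "\<not> ?thesis"
        then have "d k = ?deg k" if "k \<in> {1..n} - {r}" for k using that le[of k] by fastforce
        \<comment> \<open>With every other vertex saturated, the sum of \<open>d\<close> would
          exceed the even degree sum by exactly one.\<close>
        then have "(\<Sum>v\<in>{1..n} - {r}. d v) = (\<Sum>v\<in>{1..n} - {r}. ?deg v)" by simp
        then have "(\<Sum>v = 1..n. d v) = (\<Sum>v = 1..n. ?deg v) + 1"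
          using r dr sum.remove[of "{1..n}" r d] sum.remove[of "{1..n}" r ?deg] by simp
        then show False using ev handshake[OF G] by simp
      qed
      then obtain k where k: "k \<in> {1..n}" "k \<noteq> r" "?deg k < d k" by blast
      have rk: "{r, k} \<in> E" using adj_deficient[OF k] .
      have "u \<noteq> k" "i \<noteq> r" using u(3) rk i by (auto simp: insert_commute)
      \<comment> \<open>The edge \<open>{u, i}\<close> removed by the switch avoids
        \<open>r\<close>, so the edge from \<open>r\<close> to \<open>k\<close> survives.\<close>
      then have rkF: "{r, k} \<in> F" using rk F(2) u(2) by (auto simp: doubleton_eq_iff)
      have "k \<notin> {1..<r}" using k(3) eq by force
      let ?F = "F - {{r, k}}"
      have deg: "int (vertex_degree ?F v) = int (?deg v) + of_bool (v = r) - of_bool (v = k)" for v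
        using vertex_degree_remove[OF simple_graph_finite_edges[OF F(1)] rkF, of v] k(2)
        by (auto simp: F(4))
      show False
      proof (rule no_better[of ?F])
        show "simple_graph {1..n} ?F" using simple_graph_subset[OF F(1)] by blast
        show "\<exists>v\<in>e. v \<le> r" if "e \<in> ?F" for e using that F(3) by blast
        show "?deg r < vertex_degree ?F r" using deg[of r] k(2) by simp
        show "vertex_degree ?F v \<le> d v" if "v \<in> {1..n}" for v
          using deg[of v] le[OF that] dr by (auto split: if_splits simp: of_bool_def)
        show "vertex_degree ?F v = ?deg v" if "v \<in> {1..<r}" for v
          using deg[of v] that \<open>k \<notin> {1..<r}\<close> by (auto split: if_splits simp: of_bool_def)
      qed
    qed
  qed
  have nbr_le: "{u \<in> {1..n}. {u, k} \<in> E} = {u \<in> {1..r}. {u, k} \<in> E}" if "k \<in> {r + 1..n}" for k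
    using that r meet[of "{_, k}"] by fastforce
  \<comment> \<open>A later vertex below its bound misses some \<open>i < r\<close>. The switch with
    \<open>j = k\<close> puts its surplus on \<open>k\<close>, which has room for it.\<close>
  have deg_k: "?deg k = min r (d k)" if k: "k \<in> {r + 1..n}" for k
  proof (rule ccontr)
    assume neq: "?deg k \<noteq> min r (d k)"
    have deg_card: "?deg k = card {u \<in> {1..r}. {u, k} \<in> E}"
      using vertex_degree_neighbours[OF G, of k] nbr_le[OF k] by simp
    also have "\<dots> \<le> card {1..r}" by (rule card_mono) auto
    finally have kless: "?deg k < r" "?deg k < d k" using neq le[of k] k by auto
    have rk: "{r, k} \<in> E" using adj_deficient[of k] k kless by auto
    have "\<exists>i\<in>{1..r}. {i, k} \<notin> E"
    proof (rule ccontr)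
      assume "\<not> ?thesis"
      then have "{u \<in> {1..r}. {u, k} \<in> E} = {1..r}" by auto
      then show False using deg_card kless by simp
    qed
    then obtain i where i: "i \<in> {1..<r}" "{i, k} \<notin> E" 
      using rk by (metis atLeastAtMost_iff atLeastLessThan_iff le_neq_implies_less)
    obtain u where u: "{u, i} \<in> E" "u \<noteq> r" "{u, r} \<notin> E" using priv[OF i(1)] by blast
    obtain F where F: "simple_graph {1..n} F" "E - {{u, i}} \<subseteq> F" "\<And>e. e \<in> F \<Longrightarrow> \<exists>v\<in>e. v \<le> r"
      "\<And>v. vertex_degree F v = ?deg v + of_bool (v = r) + of_bool (v = k)"
      using subrealization_switch[OF sub r i(1) u _ _ i(2)] i k by auto
    show False
    proof (rule no_better[OF F(1,3)])
      show "vertex_degree F v \<le> d v" if "v \<in> {1..n}" for v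
        using le[OF that] less kless k by (auto simp: F(4))
      show "vertex_degree F v = ?deg v" if "v \<in> {1..<r}" for v
        using that k by (auto simp: F(4))
      show "?deg r < vertex_degree F r" by (simp add: F(4))
    qed
  qed
  \<comment> \<open>For nonadjacent \<open>i\<close> and \<open>j\<close>, the switch gives
    \<open>j\<close> a surplus, which is cancelled by deleting an edge from \<open>j\<close> to some
    \<open>w > r\<close>. Only finished vertices must keep their degree, so \<open>w\<close> may
    lose one.\<close>
  have clique: "{i, j} \<in> E" if ij: "i \<in> {1..<r}" "j \<in> {1..<r}" "i \<noteq> j" for i j
  proof (rule ccontr)
    assume nadj: "{i, j} \<notin> E"
    have priv_gt: "\<exists>u. {u, i} \<in> E \<and> u \<noteq> r \<and> {u, r} \<notin> E \<and> u > r" if i: "i \<in> {1..<r}" for i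
    proof -
      obtain u where u: "{u, i} \<in> E" "u \<noteq> r" "{u, r} \<notin> E" using priv[OF i] by blast
      \<comment> \<open>A vertex not adjacent to \<open>r\<close> cannot precede \<open>r\<close>,
        by \<open>adj_r\<close>.\<close>
      then have "u > r" using adj_r[of u] simple_graph_edge[OF G u(1)] by fastforce
      with u show ?thesis by blast
    qed
    obtain u where u: "{u, i} \<in> E" "u \<noteq> r" "{u, r} \<notin> E" "u > r"
      using priv_gt[OF ij(1)] by blast
    obtain w where w: "{w, j} \<in> E" "w > r" using priv_gt[OF ij(2)] by blast
    have j: "j \<in> {1..n}" "j \<noteq> i" using ij r by auto
    obtain F where F: "simple_graph {1..n} F" "E - {{u, i}} \<subseteq> F" "\<And>e. e \<in> F \<Longrightarrow> \<exists>v\<in>e. v \<le> r"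
      "\<And>v. vertex_degree F v = ?deg v + of_bool (v = r) + of_bool (v = j)"
      using subrealization_switch[OF sub r ij(1) u(1-3) j nadj] by auto
    have wjF: "{w, j} \<in> F" using w F(2) ij u(4) by (auto simp: doubleton_eq_iff)
    let ?F = "F - {{w, j}}"
    have "w \<noteq> j" using w(2) ij by auto
    then have deg: "int (vertex_degree ?F v) = int (?deg v) + of_bool (v = r) - of_bool (v = w)" for v
      using vertex_degree_remove[OF simple_graph_finite_edges[OF F(1)] wjF, of v]
      by (auto simp: F(4))
    show False
    proof (rule no_better[of ?F])
      show "simple_graph {1..n} ?F" using simple_graph_subset[OF F(1)] by blast
      show "\<exists>v\<in>e. v \<le> r" if "e \<in> ?F" for e using that F(3) by blast
      show "?deg r < vertex_degree ?F r" using deg[of r] w(2) by simp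
      show "vertex_degree ?F v \<le> d v" if "v \<in> {1..n}" for v
        using deg[of v] le[OF that] less by (auto split: if_splits simp: of_bool_def)
      show "vertex_degree ?F v = ?deg v" if "v \<in> {1..<r}" for v
        using deg[of v] that w(2) by (auto split: if_splits simp: of_bool_def)
    qed
  qed
  have adj: "{u, v} \<in> E" if "u \<in> {1..r}" "v \<in> {1..r}" "u \<noteq> v" for u v
    using that adj_r[of u] adj_r[of v] clique[of u v]
    by (cases "u = r"; cases "v = r") (auto simp: insert_commute)
  have "(\<Sum>v = 1..r. ?deg v) = (\<Sum>v = 1..r. r - 1) + (\<Sum>w = r + 1..n. min r (d w))"
  proof -
    have "card {u \<in> {1..r}. {u, v} \<in> E} = r - 1" if "v \<in> {1..r}" for v
    proof -
      have "{u \<in> {1..r}. {u, v} \<in> E} = {1..r} - {v}"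
        using adj[OF _ that] simple_graph_edge(3)[OF G, of v v] by auto
      then show ?thesis using that by simp
    qed
    moreover have "card {u \<in> {1..r}. {u, w} \<in> E} = min r (d w)" if "w \<in> {r + 1..n}" for w
      using deg_k[OF that] vertex_degree_neighbours[OF G, of w] nbr_le[OF that] by simp
    moreover have "{1..n} - {1..r} = {r + 1..n}" by auto
    ultimately show ?thesis using degree_sum_split[OF G, of "{1..r}"] r by simp
  qed
  then have "(\<Sum>i = 1..r. d i) \<le> (\<Sum>v = 1..r. ?deg v)" using EG by simp
  moreover have "(\<Sum>v = 1..r. ?deg v) < (\<Sum>i = 1..r. d i)"
    using r le less by (intro sum_strict_mono_ex1) auto
  ultimately show False by simp
qed

text \<open>The vertices are filled in turn. Among the subrealizations at stage
  \<open>Suc r\<close>, one with the largest degree at \<open>Suc r\<close> is chosen; by the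
  improvement step this degree is already \<open>d (Suc r)\<close>.\<close>

lemma erdos_gallai_realization:
  assumes mono: "\<And>i j. 1 \<le> i \<Longrightarrow> i \<le> j \<Longrightarrow> j \<le> n \<Longrightarrow> d j \<le> d i"
    and ev: "even (\<Sum>v = 1..n. d v)"
    and EG: "\<And>r. r \<in> {1..n} \<Longrightarrow>
      (\<Sum>i = 1..r. d i) \<le> r * (r - 1) + (\<Sum>i = r + 1..n. min r (d i))"
  shows "\<exists>E. simple_graph {1..n} E \<and> (\<forall>v\<in>{1..n}. vertex_degree E v = d v)"
proof -
  have "\<exists>E. subrealization d n (Suc r) E" if "r \<le> n" for r
    using that
  proof (induction r)
    case 0
    have "subrealization d n (Suc 0) {}"
      by (simp add: subrealization_def simple_graph_def vertex_degree_def)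
    then show ?case by blast
  next
    case (Suc r)
    let ?P = "subrealization d n (Suc r)" and ?f = "\<lambda>E. vertex_degree E (Suc r)"
    have r: "Suc r \<in> {1..n}" using Suc.prems by simp
    have bound: "?f E \<le> d (Suc r)" if "?P E" for E
      using that r by (auto simp: subrealization_def)
    obtain E0 where "?P E0" using Suc by auto
    then obtain E where E: "?P E" "\<And>E'. ?P E' \<Longrightarrow> ?f E' \<le> ?f E"
      using ex_has_greatest_nat[of ?P E0 ?f "Suc (d (Suc r))"] bound by (metis le_imp_less_Suc)
    have "?f E = d (Suc r)"
    proof (rule ccontr)
      assume "?f E \<noteq> d (Suc r)"
      then have "?f E < d (Suc r)" using bound[OF E(1)] by simp
      from subrealization_improve[OF mono ev EG[OF r] r E(1) this]
      show False using E(2) by (meson not_le)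
    qed
    \<comment> \<open>The independence condition weakens as the current vertex moves on.\<close>
    moreover have "\<And>e. e \<in> E \<Longrightarrow> \<exists>v\<in>e. v \<le> Suc (Suc r)"
      using E(1) by (meson subrealization_def le_SucI)
    moreover have "{1..<Suc (Suc r)} = insert (Suc r) {1..<Suc r}" by auto
    ultimately have "subrealization d n (Suc (Suc r)) E"
      using E(1) by (simp add: subrealization_def)
    then show ?case by blast
  qed
  from this[of n] show ?thesis by (auto simp: subrealization_def)
qed

lemma sum_list_eq_sum_shifted: "sum_list a = (\<Sum>i = 1..length a. a ! (i - 1))" for a :: "nat list"
  by (simp add: sum_list_sum_nth sum.atLeast1_atMost_eq atLeast0LessThan)

theorem erdos_gallai:
  assumes dec: "sorted_wrt (\<ge>) a" and ev: "even (sum_list a)"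
    and EG: "\<And>k. k \<in> {1..length a} \<Longrightarrow> 0 \<le> Delta a k"
  shows "graphic a"
proof -
  let ?d = "\<lambda>i. a ! (i - 1)"
  have "\<exists>E. simple_graph {1..length a} E \<and> (\<forall>v\<in>{1..length a}. vertex_degree E v = ?d v)"
  proof (rule erdos_gallai_realization)
    show "?d j \<le> ?d i" if "1 \<le> i" "i \<le> j" "j \<le> length a" for i j
    proof (cases "i = j")
      case False
      then have "i - 1 < j - 1" "j - 1 < length a" using that by auto
      then show ?thesis using dec by (auto simp: sorted_wrt_iff_nth_less)
    qed simp
    show "even (\<Sum>v = 1..length a. ?d v)" using ev by (simp only: sum_list_eq_sum_shifted)
    fix k assume k: "k \<in> {1..length a}"
    have "int (\<Sum>i = 1..k. ?d i) \<le> int (k * (k - 1) + (\<Sum>i = k + 1..length a. min k (?d i)))"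
      using EG[OF k] k by (simp add: Delta_def of_nat_diff)
    then show "(\<Sum>i = 1..k. ?d i) \<le> k * (k - 1) + (\<Sum>i = k + 1..length a. min k (?d i))"
      by (simp only: of_nat_le_iff)
  qed
  with dec show ?thesis by (simp add: graphic_def)
qed

section \<open>Padding a sequence with copies of its minimum\<close>

lemma Delta_append_replicate:
  assumes "k \<le> length s"
  shows "Delta (s @ replicate C m) k = Delta s k + int C * int (min k m)"
proof -
  let ?t = "s @ replicate C m" and ?L = "length s"
  let ?f = "\<lambda>i. int (min k (?t ! (i - 1)))"
  have "(\<Sum>i = k + 1..?L + C. ?f i) = (\<Sum>i = k + 1..?L. ?f i) + (\<Sum>i = ?L + 1..?L + C. ?f i)"
    using assms by (intro sum.ub_add_nat) simp
  also have "(\<Sum>i = k + 1..?L. ?f i) = (\<Sum>i = k + 1..?L. int (min k (s ! (i - 1))))"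
    by (intro sum.cong) (auto simp: nth_append)
  also have "(\<Sum>i = ?L + 1..?L + C. ?f i) = (\<Sum>i = ?L + 1..?L + C. int (min k m))"
    by (intro sum.cong) (auto simp: nth_append)
  also have "\<dots> = int C * int (min k m)" by simp
  finally have "(\<Sum>i = k + 1..length ?t. ?f i)
      = (\<Sum>i = k + 1..?L. int (min k (s ! (i - 1)))) + int C * int (min k m)" by simp
  moreover have "(\<Sum>i = 1..k. int (?t ! (i - 1))) = (\<Sum>i = 1..k. int (s ! (i - 1)))"
    using assms by (intro sum.cong) (auto simp: nth_append)
  ultimately show ?thesis by (simp only: Delta_def)
qed

text \<open>With \<open>p\<close> the length, the increment is \<open>2 * (k - m)\<close> if
  \<open>m\<close> is at most \<open>k\<close>, and \<open>p - 1 - m\<close> otherwise; the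
  hypothesis \<open>m < p\<close> makes the second nonnegative.\<close>

lemma Delta_Suc_const_tail:
  assumes tail: "\<And>i. i \<in> {k + 1..length t} \<Longrightarrow> t ! (i - 1) = m"
    and k: "k < length t" and m: "m < length t"
  shows "Delta t k \<le> Delta t (Suc k)"
proof -
  let ?p = "length t"
  have "(\<Sum>i = l + 1..?p. int (min l (t ! (i - 1)))) = int (?p - l) * int (min l m)" if "l \<ge> k" for l
  proof -
    have "(\<Sum>i = l + 1..?p. int (min l (t ! (i - 1)))) = (\<Sum>i = l + 1..?p. int (min l m))"
      using tail that by (intro sum.cong) auto
    then show ?thesis by simp
  qed
  note tails = this[of k] this[of "Suc k"]
  have "t ! k = m" using tail[of "Suc k"] k by simp
  then have "(\<Sum>i = 1..Suc k. int (t ! (i - 1))) = (\<Sum>i = 1..k. int (t ! (i - 1))) + int m"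
    by simp
  then have diff: "Delta t (Suc k) - Delta t k = 2 * int k + int (?p - Suc k) * int (min (Suc k) m)
      - int (?p - k) * int (min k m) - int m"
    using tails unfolding Delta_def by (simp add: algebra_simps)
  show ?thesis
  proof (cases "m \<le> k")
    case True
    then have "Delta t (Suc k) - Delta t k = 2 * int k - 2 * int m"
      using k unfolding diff by (simp add: of_nat_diff algebra_simps)
    with True show ?thesis by simp
  next
    case False
    then have "Delta t (Suc k) - Delta t k = int ?p - 1 - int m"
      using k unfolding diff by (simp add: of_nat_diff algebra_simps)
    with m show ?thesis by simp
  qed
qed

text \<open>Removes the ceiling: the deficiency is the least integer \<open>C\<close> for which
  \<open>C\<close> copies of \<open>m\<close> make up for a negative
  \<open>Delta s k\<close>.\<close>

lemma deficiency_le_iff: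
  assumes "0 < m" "0 < k"
  shows "deficiency s m k \<le> C \<longleftrightarrow> - Delta s k \<le> C * int (min k m)"
proof -
  have "deficiency s m k \<le> C \<longleftrightarrow> real_of_int (- Delta s k) \<le> real_of_int C * real (min k m)"
    unfolding deficiency_def ceiling_le_iff using assms by (intro pos_divide_le_eq) simp
  also have "\<dots> \<longleftrightarrow> real_of_int (- Delta s k) \<le> real_of_int (C * int (min k m))" by simp
  finally show ?thesis by (simp only: of_int_le_iff)
qed

text \<open>Past the first \<open>N\<close> terms the sequence is constant, and there \<open>Delta\<close> is nondecreasing; so
  the Erdos-Gallai inequalities up to \<open>N\<close> suffice.\<close>
lemma graphic_append_replicate:
  assumes dec: "sorted_wrt (\<ge>) s" and m: "0 < m" "\<And>x. x \<in> set s \<Longrightarrow> m \<le> x"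
    and N: "1 \<le> N" "N \<le> length s" and tail: "\<And>i. i \<in> {N + 1..length s} \<Longrightarrow> s ! (i - 1) = m"
    and C: "\<And>k. k \<in> {1..N} \<Longrightarrow> deficiency s m k \<le> int C"
    and ev: "even (sum_list s + C * m)"
  shows "graphic (s @ replicate C m)"
proof (rule erdos_gallai)
  let ?t = "s @ replicate C m"
  show "sorted_wrt (\<ge>) ?t"
  proof -
    have "sorted_wrt (\<ge>) (replicate C m)" by (simp add: sorted_wrt_iff_nth_less)
    then show ?thesis using dec m by (auto simp: sorted_wrt_append)
  qed
  show "even (sum_list ?t)" using ev by (simp add: sum_list_replicate)
  have head: "0 \<le> Delta ?t k" if "k \<in> {1..N}" for k
    using C[OF that] deficiency_le_iff[of m k s "int C"] that m N
    by (simp add: Delta_append_replicate)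
  \<comment> \<open>The inequality at \<open>k = 1\<close> says that the largest term is below the
    length; this yields the length condition for the monotonicity of \<open>Delta\<close> on the
    tail.\<close>
  have "Delta ?t 1 \<le> int (length ?t) - 1 - int (s ! 0)"
  proof -
    have "(\<Sum>i = 2..length ?t. int (min 1 (?t ! (i - 1)))) \<le> (\<Sum>i = 2..length ?t. 1)"
      by (intro sum_mono) auto
    moreover have "?t ! 0 = s ! 0" using N by (cases s) auto
    ultimately show ?thesis using N by (simp add: Delta_def numeral_2_eq_2 of_nat_diff)
  qed
  moreover have "m \<le> s ! 0" using N by (intro m(2) nth_mem) auto
  ultimately have len: "m < length ?t" using head[of 1] N by simp
  have tail': "?t ! (i - 1) = m" if "i \<in> {N + 1..length ?t}" for i
    using that tail[of i] by (auto simp: nth_append)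
  have "0 \<le> Delta ?t k" if "N \<le> k" "k \<le> length ?t" for k
    using that
  proof (induction k rule: dec_induct)
    case base
    then show ?case using head[of N] N by simp
  next
    case (step k)
    have "Delta ?t k \<le> Delta ?t (Suc k)"
      using step by (intro Delta_Suc_const_tail[OF _ _ len] tail') auto
    then show ?case using step by simp
  qed
  then show "0 \<le> Delta ?t k" if "k \<in> {1..length ?t}" for k
    using that head[of k] by (cases "k \<le> N") auto
qed

section \<open>Lower bound for the size of graphs with a given degree set\<close>

text \<open>Any single index \<open>k\<close> gives a bound. The Erdos-Gallai inequality for the
  images of the first \<open>k\<close> terms forces the vertices outside the image, together with
  the excess of \<open>vertex_degree E (f i)\<close> over the terms of \<open>s\<close>, to make up
  for the negative part of \<open>Delta s k\<close>.\<close>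

lemma degree_sum_gt:
  assumes G: "simple_graph V E"
    and f: "inj_on f {1..length s}" "f ` {1..length s} \<subseteq> V"
      "\<And>i. i \<in> {1..length s} \<Longrightarrow> s ! (i - 1) \<le> vertex_degree E (f i)"
    and m: "0 < m" "\<And>v. v \<in> V \<Longrightarrow> m \<le> vertex_degree E v" "\<And>x. x \<in> set s \<Longrightarrow> m \<le> x"
    and k: "k \<in> {1..length s}"
  shows "int (sum_list s) + (deficiency s m k - 1) * int m < int (\<Sum>v\<in>V. vertex_degree E v)"
proof -
  let ?deg = "vertex_degree E" and ?L = "length s" and ?s = "\<lambda>i. s ! (i - 1)"
  define R where "R = V - f ` {1..?L}"
  have finV: "finite V" using G by (simp add: simple_graph_def)
  then have finR: "finite R" by (simp add: R_def)
  have ms: "m \<le> ?s i" if "i \<in> {1..?L}" for i using that m(3)[of "?s i"] by auto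
  have inj: "inj_on f A" if "A \<subseteq> {1..?L}" for A using f(1) that by (rule inj_on_subset)
  have split: "(\<Sum>v\<in>V. ?deg v) = (\<Sum>i = 1..?L. ?deg (f i)) + (\<Sum>v\<in>R. ?deg v)"
    using sum.subset_diff[OF f(2) finV, of ?deg] f(1) by (simp add: R_def sum.reindex)
  have "deficiency s m k - 1 < deficiency s m k" by simp
  \<comment> \<open>By minimality of the ceiling, one copy fewer than the deficiency does not
    suffice.\<close>
  then have def: "(deficiency s m k - 1) * int (min k m) < - Delta s k"
    using deficiency_le_iff[of m k s "deficiency s m k - 1"] m(1) k by simp
  have card: "card (f ` {1..k}) = k" using inj[of "{1..k}"] k by (simp add: card_image)
  have "V - f ` {1..k} = f ` {k + 1..?L} \<union> R"
  proof -
    have "{1..?L} = {1..k} \<union> {k + 1..?L}" using k by auto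
    moreover have "f ` {1..k} \<inter> f ` {k + 1..?L} = {}"
      using k inj_on_image_Int[OF f(1), of "{1..k}" "{k + 1..?L}"] by auto
    ultimately show ?thesis using f(2) by (auto simp: R_def)
  qed
  moreover have "f ` {k + 1..?L} \<inter> R = {}" using k by (auto simp: R_def)
  ultimately have "(\<Sum>v\<in>V - f ` {1..k}. min k (?deg v))
      = (\<Sum>i = k + 1..?L. min k (?deg (f i))) + (\<Sum>v\<in>R. min k (?deg v))"
    using finR inj[of "{k + 1..?L}"] k by (simp add: sum.union_disjoint sum.reindex)
  moreover have "f ` {1..k} \<subseteq> V" using f(2) k by auto
  ultimately have "(\<Sum>i = 1..k. ?deg (f i)) \<le> k * (k - 1)
      + (\<Sum>i = k + 1..?L. min k (?deg (f i))) + (\<Sum>v\<in>R. min k (?deg v))"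
    using degree_sum_le[OF G, of "f ` {1..k}"] sum.reindex[OF inj[of "{1..k}"], of ?deg] k
    unfolding card by simp
  then have "int (\<Sum>i = 1..k. ?deg (f i)) \<le> int (k * (k - 1)
      + (\<Sum>i = k + 1..?L. min k (?deg (f i))) + (\<Sum>v\<in>R. min k (?deg v)))"
    by (simp only: of_nat_le_iff)
  then have EG: "(\<Sum>i = 1..k. int (?deg (f i))) \<le> int k * (int k - 1)
      + (\<Sum>i = k + 1..?L. int (min k (?deg (f i)))) + (\<Sum>v\<in>R. int (min k (?deg v)))"
    using k by (simp add: of_nat_diff)
  have low: "(\<Sum>i = 1..k. int (?s i)) \<le> (\<Sum>i = 1..k. int (?deg (f i)))"
    using f(3) k by (intro sum_mono) auto
  have sum_s: "int (sum_list s) = (\<Sum>i = 1..?L. int (?s i))"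
    by (simp only: sum_list_eq_sum_shifted of_nat_sum)
  show ?thesis
  proof (cases "k \<le> m")
    \<comment> \<open>All the minima equal \<open>k\<close>, so the inequality counts vertices: at
      least \<open>deficiency s m k\<close> of them lie in \<open>R\<close>, each of degree at least
      \<open>m\<close>.\<close>
    case True
    have "(\<Sum>i = k + 1..?L. int (min k (?deg (f i)))) = (\<Sum>i = k + 1..?L. int (min k (?s i)))"
    proof (rule sum.cong)
      fix i assume "i \<in> {k + 1..?L}"
      then have "k \<le> ?s i" "?s i \<le> ?deg (f i)" using True ms[of i] f(3)[of i] by auto
      then show "int (min k (?deg (f i))) = int (min k (?s i))" by simp
    qed simp
    moreover have "(\<Sum>v\<in>R. int (min k (?deg v))) = (\<Sum>v\<in>R. int k)"
    proof (rule sum.cong)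
      fix v assume "v \<in> R"
      then have "k \<le> ?deg v" using True m(2)[of v] by (simp add: R_def)
      then show "int (min k (?deg v)) = int k" by simp
    qed simp
    ultimately have "- Delta s k \<le> int (card R) * int k"
      using EG low by (simp add: Delta_def)
    with def True have "(deficiency s m k - 1) * int k < int (card R) * int k" by (simp add: min_def)
    then have "deficiency s m k - 1 < int (card R)" using k by simp
    then have "(deficiency s m k - 1) * int m < int (card R) * int m" using m(1) by simp
    also have "\<dots> = (\<Sum>v\<in>R. int m)" by simp
    also have "\<dots> \<le> (\<Sum>v\<in>R. int (?deg v))" using m(2) by (intro sum_mono) (auto simp: R_def)
    finally have "(deficiency s m k - 1) * int m < (\<Sum>v\<in>R. int (?deg v))" .
    moreover have "(\<Sum>i = 1..?L. int (?s i)) \<le> (\<Sum>i = 1..?L. int (?deg (f i)))"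
      using f(3) by (intro sum_mono) auto
    ultimately show ?thesis unfolding split sum_s by simp
  next
    \<comment> \<open>Here \<open>min k m = m\<close>, and the inequality bounds degrees directly.
      Raising a term to the degree of its image raises its minimum with \<open>k\<close> by at most
      the same amount.\<close>
    case False
    have "(\<Sum>i = k + 1..?L. int (min k (?deg (f i))))
        \<le> (\<Sum>i = k + 1..?L. int (min k (?s i)) + (int (?deg (f i)) - int (?s i)))"
    proof (rule sum_mono)
      fix i assume "i \<in> {k + 1..?L}"
      then have "?s i \<le> ?deg (f i)" using f(3) by simp
      then show "int (min k (?deg (f i))) \<le> int (min k (?s i)) + (int (?deg (f i)) - int (?s i))"
        by (simp add: min_def)
    qed
    moreover have "(\<Sum>v\<in>R. int (min k (?deg v))) \<le> (\<Sum>v\<in>R. int (?deg v))"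
      by (intro sum_mono) simp
    moreover have "(\<Sum>i = 1..?L. g i) = (\<Sum>i = 1..k. g i) + (\<Sum>i = k + 1..?L. g i)" for g :: "nat \<Rightarrow> int"
      using k sum.ub_add_nat[of 1 k g "?L - k"] by simp
    note this[of "\<lambda>i. int (?s i)"] this[of "\<lambda>i. int (?deg (f i))"]
    ultimately have "- Delta s k \<le> (\<Sum>i = 1..?L. int (?deg (f i))) - (\<Sum>i = 1..?L. int (?s i))
        + (\<Sum>v\<in>R. int (?deg v))"
      using EG low by (simp add: Delta_def sum.distrib sum_subtractf)
    with def False show ?thesis unfolding split sum_s by simp
  qed
qed

text \<open>Guarantees that the conversion of the number of copies to a natural number loses
  nothing. The slack of one in the length is for case (b), where a term is repeated.\<close>

lemma deficiency_1_nonneg: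
  assumes "length s \<le> s ! 0 + 1" "0 < m" "s \<noteq> []"
  shows "0 \<le> deficiency s m 1"
proof -
  have "(\<Sum>i = 2..length s. int (min 1 (s ! (i - 1)))) \<le> (\<Sum>i = 2..length s. 1)"
    by (intro sum_mono) auto
  moreover have "1 \<le> length s" using assms(3) by (cases s) auto
  ultimately have "Delta s 1 \<le> 0"
    using assms(1) by (simp add: Delta_def numeral_2_eq_2 of_nat_diff)
  then show ?thesis using assms(2) by (simp add: deficiency_def)
qed

text \<open>A realization of \<open>t\<close> shows that graphs with degree set \<open>D\<close>
  exist, so the minimum is attained and the gap can be applied to a minimal graph.\<close>

lemma least_size_gap:
  assumes graphic: "graphic t" "set t = D"
    and gap: "\<And>(V :: nat set) E. simple_graph V E \<Longrightarrow> degree_set V E = D \<Longrightarrow>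
      sum_list t < 2 * card E + 2 * m"
  shows "real (sum_list t) / 2 - real (least_size D) < real m"
proof -
  let ?P = "\<lambda>q. \<exists>(V :: nat set) E. simple_graph V E \<and> degree_set V E = D \<and> card E = q"
  obtain E where E: "simple_graph {1..length t} E"
    "\<forall>k\<in>{1..length t}. vertex_degree E k = t ! (k - 1)"
    using graphic(1) by (auto simp: graphic_def)
  have "degree_set {1..length t} E = (\<lambda>k. t ! (k - 1)) ` {1..length t}"
    using E(2) by (auto simp: degree_set_def)
  also have "\<dots> = (!) t ` {..<length t}"
  proof -
    have "{1..length t} = Suc ` {..<length t}" by (simp add: lessThan_atLeast0 atLeastLessThanSuc_atLeastAtMost)
    then show ?thesis by (simp add: image_image)
  qed
  also have "\<dots> = D" using graphic(2) by (auto simp: in_set_conv_nth)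
  finally have "?P (card E)" using E(1) by blast
  then have "?P (least_size D)" unfolding least_size_def by (rule LeastI)
  then obtain V :: "nat set" and F where "simple_graph V F" "degree_set V F = D"
    "card F = least_size D" by blast
  with gap[of V F] have "sum_list t < 2 * least_size D + 2 * m" by simp
  then have "real (sum_list t) < real (2 * least_size D + 2 * m)" by (simp only: of_nat_less_iff)
  then show ?thesis by simp
qed

text \<open>Common core of both cases: what remains for each is parity, the choice of
  \<open>N\<close>, and the embedding of \<open>s\<close> into an arbitrary graph with degree set
  \<open>D\<close>.\<close>

lemma padded_near_optimal:
  assumes dec: "sorted_wrt (\<ge>) s" and s: "set s = D" "\<And>x. x \<in> D \<Longrightarrow> m \<le> x" and m: "0 < m" "m \<in> D"
    and N: "1 \<le> N" "N \<le> length s" and tail: "\<And>i. i \<in> {N + 1..length s} \<Longrightarrow> s ! (i - 1) = m"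
    and C: "\<And>k. k \<in> {1..N} \<Longrightarrow> deficiency s m k \<le> int C"
    and ev: "even (sum_list s + C * m)"
    and k: "k \<in> {1..N}" "int C \<le> deficiency s m k + 1"
    and embed: "\<And>(V :: nat set) E. simple_graph V E \<Longrightarrow> degree_set V E = D \<Longrightarrow>
      \<exists>f. inj_on f {1..length s} \<and> f ` {1..length s} \<subseteq> V \<and>
        (\<forall>i\<in>{1..length s}. s ! (i - 1) \<le> vertex_degree E (f i))"
  shows "graphic (s @ replicate C m) \<and> set (s @ replicate C m) = D \<and>
    real (sum_list (s @ replicate C m)) / 2 - real (least_size D) < real m"
proof (intro conjI)
  show graphic: "graphic (s @ replicate C m)"
    using graphic_append_replicate[OF dec m(1) _ N tail C ev] s by blast
  show set: "set (s @ replicate C m) = D" using s(1) m(2) by auto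
  show "real (sum_list (s @ replicate C m)) / 2 - real (least_size D) < real m"
  proof (rule least_size_gap[OF graphic set])
    fix V :: "nat set" and E assume G: "simple_graph V E" "degree_set V E = D"
    obtain f where f: "inj_on f {1..length s}" "f ` {1..length s} \<subseteq> V"
      "\<forall>i\<in>{1..length s}. s ! (i - 1) \<le> vertex_degree E (f i)"
      using embed[OF G] by blast
    have "m \<le> vertex_degree E v" if "v \<in> V" for v
      using that G(2) s(2) by (auto simp: degree_set_def)
    then have "int (sum_list s) + (deficiency s m k - 1) * int m < int (\<Sum>v\<in>V. vertex_degree E v)"
      using degree_sum_gt[OF G(1) f(1,2) _ m(1)] f(3) s k(1) N by auto
    \<comment> \<open>The parity copy and the strict bound for one copy fewer than the deficiency
      cost one \<open>m\<close> each, hence a gap below \<open>2 * m\<close> in the degree sum and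
      below \<open>m\<close> in the number of edges.\<close>
    moreover have "(int C - 2) * int m \<le> (deficiency s m k - 1) * int m"
      using k(2) by (intro mult_right_mono) auto
    ultimately have "int (sum_list s) + int C * int m < int (2 * card E + 2 * m)"
      unfolding handshake[OF G(1)] by (simp add: algebra_simps)
    then have "int (sum_list (s @ replicate C m)) < int (2 * card E + 2 * m)"
      by (simp add: sum_list_replicate)
    then show "sum_list (s @ replicate C m) < 2 * card E + 2 * m" by (simp only: of_nat_less_iff)
  qed
qed

section \<open>Strictly decreasing lists and the two cases of the construction\<close>

lemma sorted_desc_nth_strict:
  fixes ds :: "nat list"
  assumes "sorted_wrt (>) ds" "i < j" "j < length ds"
  shows "ds ! j < ds ! i"
  using assms by (simp add: sorted_wrt_iff_nth_less)

lemma sorted_desc_distinct: "sorted_wrt (>) ds \<Longrightarrow> distinct ds" for ds :: "nat list"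
  by (induction ds) auto

lemma sorted_desc_last_le:
  fixes ds :: "nat list"
  assumes "sorted_wrt (>) ds" "x \<in> set ds"
  shows "last ds \<le> x"
  using assms by (induction ds) (auto split: if_splits intro: less_imp_le)

lemma sorted_desc_length_le_hd:
  fixes ds :: "nat list"
  assumes dec: "sorted_wrt (>) ds" and pos: "\<forall>d\<in>set ds. 0 < d" and ne: "ds \<noteq> []"
  shows "length ds \<le> ds ! 0"
proof -
  have "x \<le> ds ! 0" if x: "x \<in> set ds" for x
  proof -
    obtain j where "j < length ds" "x = ds ! j" using x by (auto simp: in_set_conv_nth)
    then show ?thesis using sorted_desc_nth_strict[OF dec, of 0 j] by (cases j) auto
  qed
  then have "set ds \<subseteq> {1..ds ! 0}" using pos by (auto simp: Suc_le_eq)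
  from card_mono[OF _ this] show ?thesis
    using distinct_card[OF sorted_desc_distinct[OF dec]] by simp
qed

lemma degree_representatives:
  assumes "degree_set V E = D"
  obtains g where "inj_on g D" "g ` D \<subseteq> V" "\<And>d. d \<in> D \<Longrightarrow> vertex_degree E (g d) = d"
proof -
  have "\<forall>d\<in>D. \<exists>v. v \<in> V \<and> vertex_degree E v = d" using assms by (auto simp: degree_set_def)
  then obtain g where g: "\<forall>d\<in>D. g d \<in> V \<and> vertex_degree E (g d) = d" by metis
  then have "inj_on g D" by (metis inj_onI)
  with g that show thesis by blast
qed

text \<open>The terms of \<open>ds\<close> are distinct, so choosing one vertex of each degree
  embeds them.\<close>

lemma sbar_a_near_optimal:
  assumes ne: "ds \<noteq> []" and dec: "sorted_wrt (>) ds" and pos: "\<forall>d\<in>set ds. 0 < d"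
    and par: "even (\<Sum>(set ds)) \<or> odd (last ds)"
  shows "graphic (sbar_a ds) \<and> set (sbar_a ds) = set ds \<and>
    real (sum_list (sbar_a ds)) / 2 - real (least_size (set ds)) < real (last ds)"
proof -
  let ?m = "last ds" and ?N = "max 1 (length ds - 1)"
  let ?K = "{1..?N}"
  have m: "0 < ?m" "?m \<in> set ds" using ne pos by auto
  have c_ge: "deficiency ds ?m k \<le> c_a ds" if "k \<in> ?K" for k
    unfolding c_a_def using that by (intro Max_ge) auto
  have "c_a ds \<in> deficiency ds ?m ` ?K" unfolding c_a_def by (intro Max_in) auto
  then obtain k where k: "k \<in> ?K" "c_a ds = deficiency ds ?m k" by blast
  have "0 \<le> deficiency ds ?m 1"
    using sorted_desc_length_le_hd[OF dec pos ne] m ne by (intro deficiency_1_nonneg) auto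
  then have c0: "0 \<le> c_a ds" using c_ge[of 1] by simp
  have C: "c_a ds \<le> Cstar_a ds" "Cstar_a ds \<le> c_a ds + 1" by (auto simp: Cstar_a_def)
  define C' where "C' = nat (Cstar_a ds)"
  have C': "int C' = Cstar_a ds" using C c0 by (simp add: C'_def)
  have "nat (Cstar_a ds + 1) = Suc C'" using C c0 by (simp add: C'_def nat_add_distrib)
  then have sbar: "sbar_a ds = ds @ replicate C' ?m"
    using append_butlast_last_id[OF ne] by (metis append.assoc append_Cons append_Nil replicate_Suc sbar_a_def)
  have sum: "sum_list ds = \<Sum>(set ds)"
    using distinct_sum_list_conv_Sum[OF sorted_desc_distinct[OF dec]] .
  \<comment> \<open>If \<open>last ds\<close> is odd, an extra copy flips the parity; if it is even,
    the hypothesis makes the sum even for any number of copies.\<close>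
  have "even (int (\<Sum>(set ds)) + Cstar_a ds * int ?m)"
    using par by (auto simp: Cstar_a_def simp del: of_nat_sum)
  then have "even (int (sum_list ds + C' * ?m))" unfolding sum C'[symmetric] by simp
  then have ev: "even (sum_list ds + C' * ?m)" by (simp only: even_of_nat)
  show ?thesis unfolding sbar
  proof (rule padded_near_optimal[where N = ?N and k = k])
    show "sorted_wrt (\<ge>) ds" using dec by (rule sorted_wrt_mono_rel[rotated]) auto
    show "ds ! (i - 1) = ?m" if "i \<in> {?N + 1..length ds}" for i
    proof -
      have "i = length ds" using that by auto
      then show ?thesis using ne by (simp add: last_conv_nth)
    qed
    show "?N \<le> length ds" using ne by (cases ds) auto
    show "deficiency ds ?m l \<le> int C'" if "l \<in> ?K" for l using c_ge[OF that] C C' by simp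
    show "int C' \<le> deficiency ds ?m k + 1" using C C' k by simp
    fix V :: "nat set" and E assume "simple_graph V E" "degree_set V E = set ds"
    then obtain g where g: "inj_on g (set ds)" "g ` set ds \<subseteq> V"
      "\<And>d. d \<in> set ds \<Longrightarrow> vertex_degree E (g d) = d" using degree_representatives by metis
    have mem: "ds ! (i - 1) \<in> set ds" if "i \<in> {1..length ds}" for i using that by auto
    have "inj_on (\<lambda>i. g (ds ! (i - 1))) {1..length ds}"
    proof (rule inj_onI)
      fix i j assume ij: "i \<in> {1..length ds}" "j \<in> {1..length ds}" "g (ds ! (i - 1)) = g (ds ! (j - 1))"
      then have "ds ! (i - 1) = ds ! (j - 1)" using inj_onD[OF g(1)] mem by blast
      moreover have "i - 1 < length ds" "j - 1 < length ds" using ij by auto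
      ultimately have "i - 1 = j - 1"
        using sorted_desc_distinct[OF dec] by (simp add: nth_eq_iff_index_eq)
      then show "i = j" using ij by auto
    qed
    then show "\<exists>f. inj_on f {1..length ds} \<and> f ` {1..length ds} \<subseteq> V \<and>
        (\<forall>i\<in>{1..length ds}. ds ! (i - 1) \<le> vertex_degree E (f i))"
      using mem g(2,3) by (intro exI[of _ "\<lambda>i. g (ds ! (i - 1))"]) auto
  qed (use m k ev sorted_desc_last_le[OF dec] in auto)
qed

text \<open>Repeating \<open>d_r\<close> repairs the parity. The second copy needs a vertex besides
  the chosen representatives, which the handshake lemma provides.\<close>

lemma sbar_b_near_optimal:
  assumes ne: "ds \<noteq> []" and dec: "sorted_wrt (>) ds" and pos: "\<forall>d\<in>set ds. 0 < d"
    and par: "odd (\<Sum>(set ds))" "even (last ds)"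
  shows "graphic (sbar_b ds) \<and> set (sbar_b ds) = set ds \<and>
    real (sum_list (sbar_b ds)) / 2 - real (least_size (set ds)) < real (last ds)"
proof -
  let ?m = "last ds" and ?n = "length ds" and ?s = "s_b ds"
  let ?O = "{i \<in> {1..?n}. odd (ds ! (i - 1))}"
  define r where "r = last_odd_index ds"
  have m: "0 < ?m" "?m \<in> set ds" using ne pos by auto
  have sum: "sum_list ds = \<Sum>(set ds)"
    using distinct_sum_list_conv_Sum[OF sorted_desc_distinct[OF dec]] .
  have "?O \<noteq> {}"
  proof
    assume "?O = {}"
    then have "even (\<Sum>i = 1..?n. ds ! (i - 1))" by (intro dvd_sum) auto
    then show False using par(1) sum sum_list_eq_sum_shifted[of ds] by simp
  qed
  then have "r \<in> ?O" unfolding r_def last_odd_index_def by (intro Max_in) auto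
  then have r: "1 \<le> r" "r \<le> ?n" "odd (ds ! (r - 1))" by auto
  have r_max: "i \<le> r" if "i \<in> {1..?n}" "odd (ds ! (i - 1))" for i
    unfolding r_def last_odd_index_def using that by (intro Max_ge) auto
  have "r \<noteq> ?n" using r par(2) ne by (auto simp: last_conv_nth)
  then have rn: "r < ?n" using r by simp
  have drop: "drop (r - 1) ds = ds ! (r - 1) # drop r ds"
    using Cons_nth_drop_Suc[of "r - 1" ds] r by simp
  \<comment> \<open>The two pieces overlap in \<open>d_r\<close>, which is thereby repeated.\<close>
  have s: "?s = take r ds @ drop (r - 1) ds"
    using take_Suc_conv_app_nth[of "r - 1" ds] r drop
    by (simp add: s_b_def Let_def r_def[symmetric] numeral_2_eq_2)
  have len: "length ?s = ?n + 1" using r by (simp add: s)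
  have nth: "?s ! j = (if j < r then ds ! j else ds ! (j - 1))" if "j \<le> ?n" for j
    using r that by (simp add: s nth_append)
  have "set ?s = set (take r ds @ drop r ds) \<union> {ds ! (r - 1)}"
    unfolding s drop set_append by auto
  then have set_s: "set ?s = set ds" using r by (simp add: insert_absorb)
  have "sum_list ?s = sum_list (take r ds @ drop r ds) + ds ! (r - 1)"
    unfolding s drop by (simp del: append_take_drop_id)
  then have sum_s: "sum_list ?s = sum_list ds + ds ! (r - 1)" by simp
  have desc: "sorted_wrt (\<ge>) ?s"
  proof -
    have "ds ! j \<le> ds ! i" if "i \<le> j" "j < ?n" for i j
      using sorted_desc_nth_strict[OF dec, of i j] that by (cases "i = j") auto
    then show ?thesis using rn by (auto simp: sorted_wrt_iff_nth_less len nth)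
  qed
  have C_ge: "deficiency ?s ?m k \<le> Cstar_b ds" if "k \<in> {1..?n}" for k
    unfolding Cstar_b_def using that by (intro Max_ge) auto
  have n1: "1 \<le> ?n" using ne by (cases ds) auto
  then have "Cstar_b ds \<in> deficiency ?s ?m ` {1..?n}" unfolding Cstar_b_def by (intro Max_in) auto
  then obtain k where k: "k \<in> {1..?n}" "Cstar_b ds = deficiency ?s ?m k" by blast
  have "0 \<le> deficiency ?s ?m 1"
    using sorted_desc_length_le_hd[OF dec pos ne] m nth[of 0] len r by (intro deficiency_1_nonneg) auto
  then have C': "int (nat (Cstar_b ds)) = Cstar_b ds" using C_ge[of 1] n1 by simp
  show ?thesis unfolding sbar_b_def
  proof (rule padded_near_optimal[where N = ?n and k = k])
    \<comment> \<open>Since \<open>r < ?n\<close>, the repeated term is not the last, and position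
      \<open>?n + 1\<close> of the lengthened list holds \<open>d_n\<close>.\<close>
    show "?s ! (i - 1) = ?m" if "i \<in> {?n + 1..length ?s}" for i
    proof -
      have "i = ?n + 1" using that len by auto
      then show ?thesis using nth[of ?n] rn ne by (simp add: last_conv_nth)
    qed
    show "even (sum_list ?s + nat (Cstar_b ds) * ?m)" using sum_s sum par r by simp
    show "deficiency ?s ?m l \<le> int (nat (Cstar_b ds))" if "l \<in> {1..?n}" for l
      using C_ge[OF that] C' by simp
    show "int (nat (Cstar_b ds)) \<le> deficiency ?s ?m k + 1" using C' k by simp
    fix V :: "nat set" and E assume G: "simple_graph V E" "degree_set V E = set ds"
    then obtain g where g: "inj_on g (set ds)" "g ` set ds \<subseteq> V"
      "\<And>d. d \<in> set ds \<Longrightarrow> vertex_degree E (g d) = d" using degree_representatives by metis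
    have mem: "ds ! j \<in> set ds" if "j < ?n" for j using that by simp
    have inj: "i = j" if "g (ds ! i) = g (ds ! j)" "i < ?n" "j < ?n" for i j
      using that inj_onD[OF g(1) that(1)] sorted_desc_distinct[OF dec] by (simp add: nth_eq_iff_index_eq)
    \<comment> \<open>The representatives alone have odd degree sum, while the total is
      even.\<close>
    have "\<exists>x\<in>V - g ` set ds. odd (vertex_degree E x)"
    proof (rule ccontr)
      assume "\<not> ?thesis"
      then have "even (\<Sum>v\<in>V - g ` set ds. vertex_degree E v)" by (intro dvd_sum) auto
      moreover have "(\<Sum>v\<in>g ` set ds. vertex_degree E v) = \<Sum>(set ds)"
        using g(1,3) by (simp add: sum.reindex)
      moreover have "finite V" using G by (simp add: simple_graph_def)
      ultimately have "odd (\<Sum>v\<in>V. vertex_degree E v)"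
        using sum.subset_diff[OF g(2), of "vertex_degree E"] par(1) by simp
      then show False using handshake[OF G(1)] by simp
    qed
    then obtain x where x: "x \<in> V" "x \<notin> g ` set ds" "odd (vertex_degree E x)" by blast
    \<comment> \<open>The degree of \<open>x\<close> is an odd element of \<open>D\<close>, and
      \<open>d_r\<close> is the least of these.\<close>
    have x_ge: "ds ! (r - 1) \<le> vertex_degree E x"
    proof -
      have "vertex_degree E x \<in> set ds" using x(1) G(2) by (auto simp: degree_set_def)
      then obtain j where j: "j < ?n" "vertex_degree E x = ds ! j" by (auto simp: in_set_conv_nth)
      then have "j \<le> r - 1" using r_max[of "j + 1"] x(3) by simp
      moreover have "r - 1 < ?n" using rn by simp
      ultimately show ?thesis
        using sorted_desc_nth_strict[OF dec, of j "r - 1"] j(2) by (cases "j = r - 1") auto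
    qed
    \<comment> \<open>Position \<open>r + 1\<close> holds the second \<open>d_r\<close> and goes to
      \<open>x\<close>; later positions are shifted by one against \<open>ds\<close>, hence the
      index \<open>i - 2\<close> in a list indexed from 0.\<close>
    define f where "f i = (if i \<le> r then g (ds ! (i - 1))
      else if i = r + 1 then x else g (ds ! (i - 2)))" for i
    have "inj_on f {1..length ?s}"
    proof (rule inj_onI)
      fix i j assume ij: "i \<in> {1..length ?s}" "j \<in> {1..length ?s}" "f i = f j"
      have not_x: "x \<noteq> g (ds ! l)" if "l < ?n" for l using x(2) mem[OF that] by blast
      define idx where "idx i = (if i \<le> r then i - 1 else i - 2)" for i
      have f_idx: "f l = g (ds ! idx l)" "idx l < ?n" if "l \<in> {1..length ?s}" "l \<noteq> r + 1" for l
        using that rn len by (auto simp: f_def idx_def)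
      show "i = j"
      proof (cases "i = r + 1 \<or> j = r + 1")
        case True
        have "f (r + 1) = x" by (simp add: f_def)
        then show ?thesis using True ij f_idx not_x by metis
      next
        case False
        then have "idx i = idx j" using ij f_idx inj by metis
        then show ?thesis using False ij(1,2) by (auto simp: idx_def split: if_splits)
      qed
    qed
    moreover have "f i \<in> V" if "i \<in> {1..length ?s}" for i
      using that len r x(1) g(2) mem[of "i - 1"] mem[of "i - 2"] by (auto simp: f_def)
    moreover have "?s ! (i - 1) \<le> vertex_degree E (f i)" if "i \<in> {1..length ?s}" for i
    proof -
      consider "i \<le> r" | "i = r + 1" | "r + 2 \<le> i" by linarith
      then show ?thesis
      proof cases
        case 1
        then show ?thesis using that rn nth[of "i - 1"] g(3)[OF mem[of "i - 1"]] by (simp add: f_def)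
      next
        case 2
        then show ?thesis using rn nth[of r] x_ge by (simp add: f_def)
      next
        case 3
        then show ?thesis using that len nth[of "i - 1"] g(3)[OF mem[of "i - 2"]]
          by (simp add: f_def numeral_2_eq_2)
      qed
    qed
    ultimately show "\<exists>f. inj_on f {1..length ?s} \<and> f ` {1..length ?s} \<subseteq> V \<and>
        (\<forall>i\<in>{1..length ?s}. ?s ! (i - 1) \<le> vertex_degree E (f i))" by blast
  qed (use m k desc set_s n1 len sorted_desc_last_le[OF dec] in auto)
qed

theorem theorem9:
  fixes D :: "nat set" and ds :: "nat list"
  assumes "D = set ds"
    and "ds \<noteq> []"
    and "sorted_wrt (>) ds"
    and "\<forall>d\<in>D. 0 < d"
  shows "graphic (sbar ds) \<and> set (sbar ds) = D \<and>
    real (sum_list (sbar ds)) / 2 - real (least_size D) < real (Min D)"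
proof -
  have "Min D = last ds"
    unfolding assms(1) using assms(2) sorted_desc_last_le[OF assms(3)] by (intro Min_eqI) auto
  then show ?thesis
    using sbar_a_near_optimal[of ds] sbar_b_near_optimal[of ds] assms by (auto simp: sbar_def)
qed

end
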